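(* Let $G$ be a connected bicyclic graph on $n$ vertices of type-II, formed by two cycles of length $s,t\ge3$ which meet along a path $P_{\ell+1}$ for $\ell\ge1$, with star-expansion $\mathbf{X}_G=\sum_{\lambda\vdash n}c_\lambda\,\mathfrak{st}_\lambda$. Then for $j\ge1$, \[\sum_{\substack{\lambda\vdash n\\ \ell(\lambda)=j}}c_\lambda=(-1)^{j-1}\left[\sum_{i=1}^{\ell}\binom{s+t-2(\ell+1)+i}{j}+\binom{s+t-\ell-2}{j+1}-\binom{s-1}{j+1}-\binom{t-1}{j+1}\right].\] In particular, the sum vanishes when $j\ge s+t-\ell-1$ and is non-zero for $1\le j<s+t-\ell-1$. Moreover, when $\ell=1$, and also if one formally sets $\ell=0$, the right-hand side reduces to $(-1)^{j-1}\left[\binom{s+t-2}{j+1}-\binom{s-1}{j+1}-\binom{t-1}{j+1}\right]$.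
   Context: All graphs are finite and simple. The chromatic symmetric function of a graph $G$ with vertices $v_1,\dots,v_n$ is $\mathbf{X}_G=\sum_\kappa x_{\kappa(v_1)}\cdots x_{\kappa(v_n)}$, summed over all proper colorings $\kappa:V(G)\to\mathbb{N}$. The star graph $\mathsf{St}_k$ on $k$ vertices is the tree with one central vertex adjacent to $k-1$ leaves ($\mathsf{St}_1$ is a single vertex); $\mathfrak{st}_k:=\mathbf{X}_{\mathsf{St}_k}$, and $\mathfrak{st}_\lambda:=\mathfrak{st}_{\lambda_1}\mathfrak{st}_{\lambda_2}\cdots$ for a partition $\lambda$. The set $\{\mathfrak{st}_\lambda:\lambda\vdash n\}$ is a $\mathbb{Q}$-basis (the star-basis) of the space of homogeneous symmetric functions of degree $n$, so $\mathbf{X}_G=\sum_{\lambda\vdash n}c_\lambda\mathfrak{st}_\lambda$ with uniquely determined coefficients $c_\lambda$. $\ell(\lambda)$ denotes the number of parts of $\lambda$ (not to be confused with the integer $\ell$). A bicyclic graph is a simple connected graph whose number of edges equals its number of vertices plus one. $P_h$ denotes the path on $h$ vertices. A bicyclic graph is of type-II if its unique minimal bicyclic subgraph is formed from three paths $P_{k+1},P_{\ell+1},P_{m+1}$ with $k,\ell,m\ge1$, at most one of them equal to $1$, by identifying all initial vertices to one vertex $u$ and all terminal vertices to one vertex $v$ (otherwise disjoint); equivalently, two cycles of lengths $s=\ell+k$ and $t=\ell+m$ meeting along the common path $P_{\ell+1}$, which has $\ell$ edges. Binomial coefficients $\binom ab$ with $a\ge 0$ are $0$ when $b<0$ or $b>a$.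 *)

theory Defs
  imports Complex_Main "HOL-Library.Multiset" "HOL-Library.FuncSet"
begin

text \<open>
  A monomial in the variables $x_0, x_1, \dots$ is encoded as the finite multiset of the indices
  of its variables, so that the product of monomials is the sum of multisets. A formal power
  series is an arbitrary family of coefficients indexed by monomials.
\<close>

typedef 'a mps = "UNIV :: (nat multiset \<Rightarrow> 'a) set"
  morphisms mps_coeff Abs_mps ..

setup_lifting type_definition_mps

lemma mps_eq_iff: "f = g \<longleftrightarrow> (\<forall>M. mps_coeff f M = mps_coeff g M)"
  by (metis ext mps_coeff_inject)

lemma finite_mset_splits: "finite {(A, B). A + B = (M :: 'b multiset)}"
proof -
  have "{A. A \<subseteq># M} \<subseteq> mset ` {xs. set xs \<subseteq> set_mset M \<and> length xs \<le> size M}"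
  proof
    fix A assume "A \<in> {A. A \<subseteq># M}"
    moreover obtain xs where "mset xs = A" using ex_mset by blast
    ultimately show "A \<in> mset ` {xs. set xs \<subseteq> set_mset M \<and> length xs \<le> size M}"
      by (metis (mono_tags, lifting) image_eqI mem_Collect_eq set_mset_mono set_mset_mset
          size_mset size_mset_mono)
  qed
  then have "finite {A. A \<subseteq># M}"
    using finite_lists_length_le[of "set_mset M" "size M"] finite_surj by blast
  moreover have "{(A, B). A + B = M} \<subseteq> (\<lambda>A. (A, M - A)) ` {A. A \<subseteq># M}"
    by force
  ultimately show ?thesis
    using finite_surj by blast
qed

instantiation mps :: (comm_ring_1) comm_ring_1
begin

lift_definition zero_mps :: "'a mps" is "\<lambda>_. 0" .
lift_definition one_mps :: "'a mps" is "\<lambda>M. if M = {#} then 1 else 0" .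
lift_definition plus_mps :: "'a mps \<Rightarrow> 'a mps \<Rightarrow> 'a mps" is "\<lambda>f g M. f M + g M" .
lift_definition minus_mps :: "'a mps \<Rightarrow> 'a mps \<Rightarrow> 'a mps" is "\<lambda>f g M. f M - g M" .
lift_definition uminus_mps :: "'a mps \<Rightarrow> 'a mps" is "\<lambda>f M. - f M" .
lift_definition times_mps :: "'a mps \<Rightarrow> 'a mps \<Rightarrow> 'a mps"
  is "\<lambda>f g M. \<Sum>(A, B)\<in>{(A, B). A + B = M}. f A * g B" .

instance
proof
  fix a b c :: "'a mps"
  show "a * b * c = a * (b * c)"
  proof (transfer, rule ext)
    fix a b c :: "nat multiset \<Rightarrow> 'a" and M
    have "(\<Sum>(A, B)\<in>{(A, B). A + B = M}. (\<Sum>(C, D)\<in>{(C, D). C + D = A}. a C * b D) * c B)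
      = (\<Sum>p\<in>{(A, B). A + B = M}. \<Sum>q\<in>{(C, D). C + D = fst p}. a (fst q) * b (snd q) * c (snd p))"
      by (simp add: sum_distrib_right case_prod_beta)
    also have "\<dots> = (\<Sum>(p, q)\<in>(SIGMA p:{(A, B). A + B = M}. {(C, D). C + D = fst p}).
        a (fst q) * b (snd q) * c (snd p))"
      by (rule sum.Sigma) (auto simp: finite_mset_splits)
    also have "\<dots> = (\<Sum>(p, q)\<in>(SIGMA p:{(A, B). A + B = M}. {(C, D). C + D = snd p}).
        a (fst p) * (b (fst q) * c (snd q)))"
      by (rule sum.reindex_bij_witness[of _ "\<lambda>((A, B), (C, D)). ((A + C, D), (A, C))"
            "\<lambda>((A, B), (C, D)). ((C, D + B), (D, B))"]) (auto simp: ac_simps)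
    also have "\<dots> = (\<Sum>p\<in>{(A, B). A + B = M}. \<Sum>q\<in>{(C, D). C + D = snd p}.
        a (fst p) * (b (fst q) * c (snd q)))"
      by (rule sum.Sigma[symmetric]) (auto simp: finite_mset_splits)
    also have "\<dots> = (\<Sum>(A, B)\<in>{(A, B). A + B = M}. a A * (\<Sum>(C, D)\<in>{(C, D). C + D = B}. b C * c D))"
      by (simp add: sum_distrib_left case_prod_beta)
    finally show "(\<Sum>(A, B)\<in>{(A, B). A + B = M}. (\<Sum>(A, B)\<in>{(C, D). C + D = A}. a A * b B) * c B)
      = (\<Sum>(A, B)\<in>{(A, B). A + B = M}. a A * (\<Sum>(A, B)\<in>{(C, D). C + D = B}. b A * c B))" .
  qed
  show "a * b = b * a"
    by (transfer, rule ext, rule sum.reindex_bij_witness[of _ "\<lambda>(A, B). (B, A)" "\<lambda>(A, B). (B, A)"])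
      (auto simp: ac_simps)
  show "1 * a = a"
  proof (transfer, rule ext)
    fix a :: "nat multiset \<Rightarrow> 'a" and M
    have "(\<Sum>(A, B)\<in>{(A, B). A + B = M}. (if A = {#} then 1 else 0) * a B)
      = (\<Sum>(A, B)\<in>{({#} :: nat multiset, M)}. (if A = {#} then 1 else 0) * a B)"
      by (rule sum.mono_neutral_right) (auto simp: finite_mset_splits split: if_splits)
    then show "(\<Sum>(A, B)\<in>{(A, B). A + B = M}. (if A = {#} then 1 else 0) * a B) = a M"
      by simp
  qed
  show "(a + b) * c = a * c + b * c"
    by (transfer, rule ext) (simp add: case_prod_beta distrib_right sum.distrib)
  show "(0 :: 'a mps) \<noteq> 1"
    by transfer (metis one_neq_zero)
qed (transfer; simp add: algebra_simps)+

end

lift_definition mps_scale :: "'a::comm_ring_1 \<Rightarrow> 'a mps \<Rightarrow> 'a mps" is "\<lambda>c f M. c * f M" .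

type_synonym 'a sgraph = "'a set \<times> 'a set set"

abbreviation verts :: "'a sgraph \<Rightarrow> 'a set" where "verts G \<equiv> fst G"
abbreviation edges :: "'a sgraph \<Rightarrow> 'a set set" where "edges G \<equiv> snd G"

definition simple_graph :: "'a sgraph \<Rightarrow> bool" where
  "simple_graph G \<longleftrightarrow> finite (verts G) \<and> (\<forall>e\<in>edges G. e \<subseteq> verts G \<and> card e = 2)"

definition connected_graph :: "'a sgraph \<Rightarrow> bool" where
  "connected_graph G \<longleftrightarrow> verts G \<noteq> {} \<and>
     (\<forall>u\<in>verts G. \<forall>v\<in>verts G. (u, v) \<in> {(x, y). {x, y} \<in> edges G}\<^sup>*)"

definition subgraph :: "'a sgraph \<Rightarrow> 'a sgraph \<Rightarrow> bool" where
  "subgraph H G \<longleftrightarrow> simple_graph H \<and> verts H \<subseteq> verts G \<and> edges H \<subseteq> edges G"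

definition bicyclic :: "'a sgraph \<Rightarrow> bool" where
  "bicyclic G \<longleftrightarrow> simple_graph G \<and> connected_graph G \<and> card (edges G) = card (verts G) + 1"

definition minimal_bicyclic_subgraph :: "'a sgraph \<Rightarrow> 'a sgraph \<Rightarrow> bool" where
  "minimal_bicyclic_subgraph H G \<longleftrightarrow> subgraph H G \<and> bicyclic H \<and>
     (\<forall>H'. subgraph H' H \<and> bicyclic H' \<longrightarrow> H' = H)"

text \<open>A path is given by the list of its vertices; \<open>P\<^sub>h\<close> corresponds to a distinct list of length \<open>h\<close>.\<close>

definition path_edges :: "'a list \<Rightarrow> 'a set set" where
  "path_edges p = {{p ! i, p ! Suc i} | i. Suc i < length p}"

text \<open>
  Three paths with \<open>k\<close>, \<open>l\<close> and \<open>m\<close> edges, glued at their initial and at their terminal vertices.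
  At most one of \<open>k\<close>, \<open>l\<close>, \<open>m\<close> may be 1, since otherwise a multiple edge would arise. The cycles of
  lengths \<open>l + k\<close> and \<open>l + m\<close> meet along the path with \<open>l\<close> edges.
\<close>

definition theta_graph :: "nat \<Rightarrow> nat \<Rightarrow> nat \<Rightarrow> 'a sgraph \<Rightarrow> bool" where
  "theta_graph k l m H \<longleftrightarrow>
     k \<ge> 1 \<and> l \<ge> 1 \<and> m \<ge> 1 \<and>
     \<not> (k = 1 \<and> l = 1) \<and> \<not> (k = 1 \<and> m = 1) \<and> \<not> (l = 1 \<and> m = 1) \<and>
     (\<exists>u v p q r.
        distinct p \<and> length p = k + 1 \<and> hd p = u \<and> last p = v \<and>
        distinct q \<and> length q = l + 1 \<and> hd q = u \<and> last q = v \<and>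
        distinct r \<and> length r = m + 1 \<and> hd r = u \<and> last r = v \<and>
        set p \<inter> set q = {u, v} \<and> set p \<inter> set r = {u, v} \<and> set q \<inter> set r = {u, v} \<and>
        verts H = set p \<union> set q \<union> set r \<and>
        edges H = path_edges p \<union> path_edges q \<union> path_edges r)"

definition type_II_bicyclic :: "nat \<Rightarrow> nat \<Rightarrow> nat \<Rightarrow> 'a sgraph \<Rightarrow> bool" where
  "type_II_bicyclic k l m G \<longleftrightarrow>
     bicyclic G \<and> (\<exists>H. minimal_bicyclic_subgraph H G \<and> theta_graph k l m H)"

definition star_graph :: "nat \<Rightarrow> nat sgraph" where
  "star_graph k = ({0..<k}, {{0, i} | i. 1 \<le> i \<and> i < k})"

definition proper_colorings :: "'a sgraph \<Rightarrow> ('a \<Rightarrow> nat) set" where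
  "proper_colorings G =
     {\<kappa> \<in> verts G \<rightarrow>\<^sub>E UNIV. \<forall>u v. {u, v} \<in> edges G \<longrightarrow> \<kappa> u \<noteq> \<kappa> v}"

text \<open>
  The infinite sum of the monomials $x_{\kappa(v_1)} \cdots x_{\kappa(v_n)}$ over all proper
  colorings $\kappa$: the coefficient of a monomial is the (finite) number of proper colorings
  that produce it.
\<close>

definition chromatic_sym :: "'a sgraph \<Rightarrow> rat mps" where
  "chromatic_sym G = Abs_mps (\<lambda>M.
     of_nat (card {\<kappa> \<in> proper_colorings G. image_mset \<kappa> (mset_set (verts G)) = M}))"

text \<open>Integer partitions are encoded as multisets of their parts; the number of parts is \<open>size\<close>.\<close>

definition partitions :: "nat \<Rightarrow> nat multiset set" where
  "partitions n = {lam. 0 \<notin># lam \<and> sum_mset lam = n}"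

lemma finite_partitions: "finite (partitions n)"
proof -
  have le: "size A \<le> sum_mset A" if "0 \<notin># A" for A :: "nat multiset"
    using that by (induction A) (auto simp: Suc_le_eq)
  have "partitions n \<subseteq> mset ` {xs. set xs \<subseteq> {..n} \<and> length xs \<le> n}"
  proof
    fix A assume A: "A \<in> partitions n"
    obtain xs where xs: "mset xs = A" using ex_mset by blast
    have "x \<le> n" if "x \<in># A" for x
      using A that by (auto simp: partitions_def dest!: multi_member_split)
    moreover have "size A \<le> n"
      using A le by (auto simp: partitions_def)
    ultimately show "A \<in> mset ` {xs. set xs \<subseteq> {..n} \<and> length xs \<le> n}"
      using xs by (auto intro!: image_eqI[of _ _ xs])
  qed
  then show ?thesis
    using finite_lists_length_le[of "{..n}" n] finite_surj by blast
qed

definition star_fun :: "nat \<Rightarrow> rat mps" where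
  "star_fun k = chromatic_sym (star_graph k)"

definition star_prod :: "nat multiset \<Rightarrow> rat mps" where
  "star_prod lam = (\<Prod>k\<in>#lam. star_fun k)"

text \<open>
  For the parameters of a type-II graph, and also for \<open>s, t \<ge> 3\<close> and \<open>l \<le> 1\<close>, none of the
  subtractions of natural numbers is truncated. When \<open>l = 0\<close> the inner sum is empty.
\<close>

definition type_II_formula :: "nat \<Rightarrow> nat \<Rightarrow> nat \<Rightarrow> nat \<Rightarrow> rat" where
  "type_II_formula s t l j = (-1) ^ (j - 1) *
     ((\<Sum>i = 1..l. of_nat ((s + t - 2 * (l + 1) + i) choose j))
      + of_nat ((s + t - l - 2) choose (j + 1))
      - of_nat ((s - 1) choose (j + 1))
      - of_nat ((t - 1) choose (j + 1)))"

end

theory Submission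
  imports Defs "HOL-Computational_Algebra.Polynomial"
begin

text \<open>
  Setting $N$ variables to 1 and the others to 0 turns the star expansion into
  $\chi_G(N) = \sum_\lambda c_\lambda N^{\ell(\lambda)} (N-1)^{n - \ell(\lambda)}$, so with
  $y = N/(N-1)$ the quotient $\chi_G(N)/(N-1)^n$ is the polynomial
  $\sum_j y^j \sum_{\ell(\lambda) = j} c_\lambda$. This quotient does not change when a leaf is added,
  and every connected graph with the same number of independent cycles as a subgraph $H$ arises from
  $H$ by adding leaves; hence $G$ may be replaced by its theta subgraph. There the colourings are
  counted path by path between the two branch vertices, and in terms of $x = 1 - y = -1/(N-1)$ one finds
  \[ y \cdot \chi_G(N)/(N-1)^n
    = 1 - x^{k+\ell-1} - x^{k+m-1} - x^{\ell+m-1} + x^{k+\ell+m-2} + x^{k+\ell+m-1}. \]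
  Both sides are polynomials in $y$ agreeing at infinitely many points, so the coefficients can be compared.
\<close>

section \<open>Specialisation of finitely many variables to one\<close>

definition homogeneous :: "nat \<Rightarrow> 'a::comm_ring_1 mps \<Rightarrow> bool" where
  "homogeneous d f \<longleftrightarrow> (\<forall>M. mps_coeff f M \<noteq> 0 \<longrightarrow> size M = d)"

text \<open>
  The value of the degree \<open>d\<close> part at $x_0 = \dots = x_{N-1} = 1$, $x_N = x_{N+1} = \dots = 0$.
  Fixing the degree keeps the sum finite.
\<close>

definition ones_eval :: "nat \<Rightarrow> nat \<Rightarrow> 'a::comm_ring_1 mps \<Rightarrow> 'a" where
  "ones_eval N d f = (\<Sum>M\<in>multisets_of_size {..<N} d. mps_coeff f M)"

lemma ones_eval_sum: "ones_eval N d (\<Sum>i\<in>I. f i) = (\<Sum>i\<in>I. ones_eval N d (f i))"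
proof -
  have add: "ones_eval N d (g + h) = ones_eval N d g + ones_eval N d h" for g h :: "'a mps"
    by (simp add: ones_eval_def plus_mps.rep_eq sum.distrib)
  have zero: "ones_eval N d (0 :: 'a mps) = 0"
    by (simp add: ones_eval_def zero_mps.rep_eq)
  show ?thesis
    by (induction I rule: infinite_finite_induct) (simp_all add: add zero)
qed

lemma ones_eval_scale: "ones_eval N d (mps_scale a f) = a * ones_eval N d f"
  by (simp add: ones_eval_def mps_scale.rep_eq sum_distrib_left)

lemma homogeneous_one: "homogeneous 0 1"
  by (simp add: homogeneous_def one_mps.rep_eq)

lemma ones_eval_one: "ones_eval N 0 1 = 1"
  by (simp add: ones_eval_def one_mps.rep_eq)

lemma homogeneous_mult:
  assumes "homogeneous a f" "homogeneous b g"
  shows "homogeneous (a + b) (f * g)"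
  unfolding homogeneous_def
proof (intro allI impI)
  fix M assume "mps_coeff (f * g) M \<noteq> 0"
  then have "(\<Sum>(A, B)\<in>{(A, B). A + B = M}. mps_coeff f A * mps_coeff g B) \<noteq> 0"
    by (simp add: times_mps.rep_eq)
  then obtain p where "p \<in> {(A, B). A + B = M}"
      "(case p of (A, B) \<Rightarrow> mps_coeff f A * mps_coeff g B) \<noteq> 0"
    by (rule sum.not_neutral_contains_not_neutral)
  then have "fst p + snd p = M" "mps_coeff f (fst p) * mps_coeff g (snd p) \<noteq> 0"
    by (simp_all add: case_prod_beta)
  then have "fst p + snd p = M" "mps_coeff f (fst p) \<noteq> 0" "mps_coeff g (snd p) \<noteq> 0"
    by (blast dest: mult_not_zero)+
  moreover from this have "size (fst p) = a" "size (snd p) = b"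
    using assms unfolding homogeneous_def by blast+
  then have "size (fst p + snd p) = a + b"
    by simp
  ultimately show "size M = a + b"
    by simp
qed

text \<open>Homogeneity makes the truncated evaluation multiplicative: among all splittings of a
  monomial of size \<open>a + b\<close>, only those into sizes \<open>a\<close> and \<open>b\<close>
  can have a non-zero product of coefficients.\<close>

lemma ones_eval_mult:
  assumes f: "homogeneous a f" and g: "homogeneous b g"
  shows "ones_eval N (a + b) (f * g) = ones_eval N a f * ones_eval N b g"
proof -
  let ?S = "multisets_of_size {..<N}"
  have fin: "finite (?S d)" for d
    by auto
  have "ones_eval N (a + b) (f * g)
      = (\<Sum>M\<in>?S (a + b). \<Sum>p\<in>{(A, B). A + B = M}. mps_coeff f (fst p) * mps_coeff g (snd p))"
    by (simp add: ones_eval_def times_mps.rep_eq case_prod_beta)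
  also have "\<dots> = (\<Sum>(M, p)\<in>(SIGMA M:?S (a + b). {(A, B). A + B = M}).
      mps_coeff f (fst p) * mps_coeff g (snd p))"
    by (rule sum.Sigma) (auto simp: finite_mset_splits)
  also have "\<dots> = (\<Sum>(M, p)\<in>(\<lambda>p. (fst p + snd p, p)) ` (?S a \<times> ?S b).
      mps_coeff f (fst p) * mps_coeff g (snd p))"
  proof (rule sum.mono_neutral_right)
    show "finite (SIGMA M:?S (a + b). {(A, B). A + B = M})"
      by (intro finite_SigmaI fin) (simp add: finite_mset_splits)
    show "(\<lambda>p. (fst p + snd p, p)) ` (?S a \<times> ?S b)
        \<subseteq> (SIGMA M:?S (a + b). {(A, B). A + B = M})"
      by (auto simp: multisets_of_size_def)
    show "\<forall>i\<in>(SIGMA M:?S (a + b). {(A, B). A + B = M})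
        - (\<lambda>p. (fst p + snd p, p)) ` (?S a \<times> ?S b).
        (case i of (M, p) \<Rightarrow> mps_coeff f (fst p) * mps_coeff g (snd p)) = 0"
    proof
      fix i assume i: "i \<in> (SIGMA M:?S (a + b). {(A, B). A + B = M})
        - (\<lambda>p. (fst p + snd p, p)) ` (?S a \<times> ?S b)"
      then obtain A B where AB: "i = (A + B, (A, B))" "A + B \<in> ?S (a + b)"
        by auto
      with i have "\<not> (A \<in> ?S a \<and> B \<in> ?S b)"
        by force
      with AB(2) have "size A \<noteq> a \<or> size B \<noteq> b"
        by (auto simp: multisets_of_size_def)
      then have "mps_coeff f A = 0 \<or> mps_coeff g B = 0"
        using f g unfolding homogeneous_def by blast
      then show "(case i of (M, p) \<Rightarrow> mps_coeff f (fst p) * mps_coeff g (snd p)) = 0"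
        using AB(1) by auto
    qed
  qed
  also have "\<dots> = (\<Sum>p\<in>?S a \<times> ?S b. mps_coeff f (fst p) * mps_coeff g (snd p))"
    by (subst sum.reindex) (auto simp: inj_on_def)
  also have "\<dots> = ones_eval N a f * ones_eval N b g"
    by (simp add: ones_eval_def sum_product sum.cartesian_product case_prod_beta)
  finally show ?thesis .
qed

section \<open>Counting colourings\<close>

text \<open>Vertices and edges are separate arguments because the inductions below pass through
  intermediate graphs.\<close>

definition colorings :: "nat set \<Rightarrow> 'a set \<Rightarrow> 'a set set \<Rightarrow> ('a \<Rightarrow> nat) set" where
  "colorings C V E = {\<kappa> \<in> V \<rightarrow>\<^sub>E C. \<forall>u v. {u, v} \<in> E \<longrightarrow> \<kappa> u \<noteq> \<kappa> v}"

lemma finite_colorings: "finite V \<Longrightarrow> finite C \<Longrightarrow> finite (colorings C V E)"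
  by (simp add: colorings_def finite_PiE)

lemma homogeneous_chromatic_sym:
  "homogeneous (card (verts G)) (chromatic_sym G)"
  unfolding homogeneous_def chromatic_sym_def
  by (auto simp: Abs_mps_inverse card_gt_0_iff)

lemma ones_eval_chromatic_sym:
  assumes "finite (verts G)"
  shows "ones_eval N (card (verts G)) (chromatic_sym G)
    = of_nat (card (colorings {..<N} (verts G) (edges G)))"
proof -
  let ?T = "colorings {..<N} (verts G) (edges G)"
  let ?S = "multisets_of_size {..<N} (card (verts G))"
  let ?g = "\<lambda>\<kappa>. image_mset \<kappa> (mset_set (verts G))"
  \<comment> \<open>A colouring whose monomial \<open>M\<close> involves only indices below
    \<open>N\<close> uses only colours below \<open>N\<close>, so in each fibre the infinite palette
    may be replaced by \<open>{..<N}\<close>.\<close>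
  have "{\<kappa> \<in> proper_colorings G. ?g \<kappa> = M} = {\<kappa> \<in> ?T. ?g \<kappa> = M}" if "M \<in> ?S" for M
  proof -
    have "\<kappa> v < N" if "?g \<kappa> = M" "v \<in> verts G" for \<kappa> v
    proof -
      have "\<kappa> v \<in> set_mset (?g \<kappa>)"
        using \<open>v \<in> verts G\<close> assms by simp
      then show ?thesis
        using \<open>M \<in> ?S\<close> \<open>?g \<kappa> = M\<close> by (auto simp: multisets_of_size_def)
    qed
    then show ?thesis
      by (auto simp: proper_colorings_def colorings_def PiE_iff)
  qed
  then have "ones_eval N (card (verts G)) (chromatic_sym G)
      = of_nat (\<Sum>M\<in>?S. \<Sum>\<kappa>\<in>{\<kappa> \<in> ?T. ?g \<kappa> = M}. 1)"
    by (simp add: ones_eval_def chromatic_sym_def Abs_mps_inverse)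
  also have "(\<Sum>M\<in>?S. \<Sum>\<kappa>\<in>{\<kappa> \<in> ?T. ?g \<kappa> = M}. 1) = (\<Sum>\<kappa>\<in>?T. 1)"
  proof (rule sum.group)
    show "?g ` ?T \<subseteq> ?S"
      using assms by (auto simp: colorings_def multisets_of_size_def PiE_iff)
  qed (auto simp: finite_colorings assms)
  finally show ?thesis
    by simp
qed

text \<open>Restricting to \<open>V\<close> and recording the colour of \<open>x\<close> is a
  bijection, as that colour only has to avoid the colours of the neighbours in \<open>A\<close>. The
  weight \<open>F\<close> is carried along because the ear argument has to track the colours of the
  ends.\<close>

lemma sum_colorings_insert:
  assumes "finite C" "finite V" "x \<notin> V" "A \<subseteq> V" "\<And>e. e \<in> E \<Longrightarrow> e \<subseteq> V"
  shows "(\<Sum>\<kappa>\<in>colorings C (insert x V) (E \<union> (\<lambda>u. {u, x}) ` A). F \<kappa>)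
    = (\<Sum>\<kappa>\<in>colorings C V E. \<Sum>c\<in>C - \<kappa> ` A. F (\<kappa>(x := c)))"
proof -
  have "(\<Sum>\<kappa>\<in>colorings C V E. \<Sum>c\<in>C - \<kappa> ` A. F (\<kappa>(x := c)))
      = (\<Sum>(\<kappa>, c)\<in>(SIGMA \<kappa>:colorings C V E. C - \<kappa> ` A). F (\<kappa>(x := c)))"
    by (rule sum.Sigma) (auto simp: assms finite_colorings)
  also have "\<dots> = (\<Sum>\<kappa>\<in>colorings C (insert x V) (E \<union> (\<lambda>u. {u, x}) ` A). F \<kappa>)"
  \<comment> \<open>Colourings are extensional functions, so forgetting \<open>x\<close> means
    resetting its value to \<open>undefined\<close>.\<close>
  proof (rule sum.reindex_bij_witness[of _ "\<lambda>\<kappa>. (\<kappa>(x := undefined), \<kappa> x)" "\<lambda>(\<kappa>, c). \<kappa>(x := c)"])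
    fix p assume "p \<in> (SIGMA \<kappa>:colorings C V E. C - \<kappa> ` A)"
    then obtain \<kappa> c where p: "p = (\<kappa>, c)" "\<kappa> \<in> colorings C V E" "c \<in> C" "c \<notin> \<kappa> ` A"
      by auto
    have "\<kappa> x = undefined"
      using p(2) assms(3) by (auto simp: colorings_def PiE_iff extensional_def)
    then show "((case p of (\<kappa>, c) \<Rightarrow> \<kappa>(x := c))(x := undefined), (case p of (\<kappa>, c) \<Rightarrow> \<kappa>(x := c)) x) = p"
      using p(1) by auto
    show "(case p of (\<kappa>, c) \<Rightarrow> \<kappa>(x := c)) \<in> colorings C (insert x V) (E \<union> (\<lambda>u. {u, x}) ` A)"
    proof -
      have "(\<kappa>(x := c)) u \<noteq> (\<kappa>(x := c)) v" if uv: "{u, v} \<in> E \<union> (\<lambda>u. {u, x}) ` A" for u v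
      proof (cases "{u, v} \<in> E")
        case True
        then have "u \<noteq> x" "v \<noteq> x"
          using assms(3,5) by blast+
        then show ?thesis
          using True p(2) by (auto simp: colorings_def)
      next
        case False
        then obtain a where "a \<in> A" "{u, v} = {a, x}"
          using uv by blast
        moreover have "a \<noteq> x"
          using \<open>a \<in> A\<close> assms(3,4) by auto
        ultimately show ?thesis
          using p(4) by (auto simp: doubleton_eq_iff)
      qed
      then show ?thesis
        using p by (auto simp: colorings_def PiE_iff extensional_def)
    qed
    show "F (case p of (\<kappa>, c) \<Rightarrow> \<kappa>(x := c)) = (case p of (\<kappa>, c) \<Rightarrow> F (\<kappa>(x := c)))"
      using p(1) by simp
  next
    fix \<kappa> assume k: "\<kappa> \<in> colorings C (insert x V) (E \<union> (\<lambda>u. {u, x}) ` A)"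
    show "(case (\<kappa>(x := undefined), \<kappa> x) of (\<kappa>, c) \<Rightarrow> \<kappa>(x := c)) = \<kappa>"
      by simp
    have "(\<kappa>(x := undefined)) u \<noteq> (\<kappa>(x := undefined)) v" if "{u, v} \<in> E" for u v
    proof -
      have "u \<noteq> x" "v \<noteq> x"
        using that assms(3,5) by blast+
      then show ?thesis
        using k that by (auto simp: colorings_def)
    qed
    moreover have "\<kappa> x \<notin> (\<kappa>(x := undefined)) ` A"
    proof
      assume "\<kappa> x \<in> (\<kappa>(x := undefined)) ` A"
      then obtain a where a: "a \<in> A" "\<kappa> x = (\<kappa>(x := undefined)) a"
        by blast
      then have "a \<noteq> x"
        using assms(3,4) by auto
      moreover have "\<kappa> a \<noteq> \<kappa> x"
        using k a(1) unfolding colorings_def by blast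
      ultimately show False
        using a(2) by simp
    qed
    ultimately show "(\<kappa>(x := undefined), \<kappa> x) \<in> (SIGMA \<kappa>:colorings C V E. C - \<kappa> ` A)"
      using k assms(3) by (auto simp: colorings_def PiE_iff extensional_def)
  qed
  finally show ?thesis
    by simp
qed

lemma card_colorings_add_leaf:
  assumes "finite C" "finite V" "x \<notin> V" "u \<in> V" "\<And>e. e \<in> E \<Longrightarrow> e \<subseteq> V"
  shows "card (colorings C (insert x V) (insert {u, x} E)) = card (colorings C V E) * (card C - 1)"
proof -
  have "card (C - {\<kappa> u}) = card C - 1" if "\<kappa> \<in> colorings C V E" for \<kappa>
    using that assms by (intro card_Diff_singleton) (auto simp: colorings_def)
  then show ?thesis
    using sum_colorings_insert[of C V x "{u}" E "\<lambda>_. 1 :: nat"] assms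
    by simp
qed

lemma card_colorings_singleton: "card (colorings C {x} {}) = card C"
  by (simp add: colorings_def card_PiE)

section \<open>Star graphs and products of star functions\<close>

lemma card_colorings_star_graph:
  assumes "k \<ge> 1" "finite C"
  shows "card (colorings C (verts (star_graph k)) (edges (star_graph k))) = card C * (card C - 1) ^ (k - 1)"
  using assms(1)
proof (induction k rule: dec_induct)
  case base
  then show ?case
    using card_colorings_singleton[of C "0::nat"] by (simp add: star_graph_def atLeast0LessThan lessThan_Suc)
next
  case (step k)
  have "edges (star_graph (Suc k)) = insert {0, k} (edges (star_graph k))"
    using step.hyps by (auto simp: star_graph_def less_Suc_eq)
  moreover have "verts (star_graph (Suc k)) = insert k (verts (star_graph k))"
    by (auto simp: star_graph_def)
  moreover have "card (colorings C (insert k (verts (star_graph k))) (insert {0, k} (edges (star_graph k))))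
      = card (colorings C (verts (star_graph k)) (edges (star_graph k))) * (card C - 1)"
    using step.hyps assms(2) by (intro card_colorings_add_leaf) (auto simp: star_graph_def)
  ultimately show ?case
    using step by (cases k) (simp_all add: mult.assoc mult.commute)
qed

text \<open>A star on k >= 1 vertices has N (N-1)^(k-1) = (N/(N-1)) (N-1)^k colourings, so each part
  gives one factor N/(N-1), while the power of N-1 depends only on the sum of the parts. Homogeneity
  is proved alongside because \<open>ones_eval_mult\<close> requires it.\<close>

lemma star_prod_homogeneous_eval:
  assumes "0 \<notin># lam"
  shows "homogeneous (sum_mset lam) (star_prod lam)"
    and "N \<ge> 2 \<Longrightarrow> ones_eval N (sum_mset lam) (star_prod lam)
      = (of_nat N / of_nat (N - 1)) ^ size lam * of_nat (N - 1) ^ sum_mset lam"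
  using assms
proof (induction lam)
  case empty
  {
    case 1
    then show ?case
      by (simp add: star_prod_def homogeneous_one)
  next
    case 2
    then show ?case
      by (simp add: star_prod_def ones_eval_one)
  }
next
  case (add k lam)
  have k: "k \<ge> 1" if "0 \<notin># add_mset k lam"
    using that by (cases k) auto
  have card: "card (verts (star_graph k)) = k" "finite (verts (star_graph k))"
    by (auto simp: star_graph_def)
  have hom: "homogeneous k (star_fun k)"
    using homogeneous_chromatic_sym[of "star_graph k"] by (simp add: star_fun_def card)
  have prod: "star_prod (add_mset k lam) = star_fun k * star_prod lam"
    by (simp add: star_prod_def)
  {
    case 1
    then show ?case
      using add.IH(1) hom by (simp add: prod homogeneous_mult)
  next
    case 2
    have "ones_eval N k (star_fun k) = of_nat (N * (N - 1) ^ (k - 1))"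
      using ones_eval_chromatic_sym[OF card(2), of N] card_colorings_star_graph[OF k, of "{..<N}"] 2
      by (simp add: star_fun_def card)
    also have "\<dots> = (of_nat N / of_nat (N - 1)) * of_nat (N - 1) ^ k"
      using k 2 by (cases k) auto
    finally have "ones_eval N k (star_fun k) = (of_nat N / of_nat (N - 1)) * of_nat (N - 1) ^ k" .
    then show ?case
      using 2 add.IH hom
      by (simp add: prod ones_eval_mult power_add)
  }
qed


text \<open>\<open>V\<close> and \<open>E\<close> have the same excess of edges over vertices as
  \<open>G\<close>. Adding an edge that leaves \<open>V\<close>, with its outer end, preserves the
  excess and multiplies the count by \<open>card C - 1\<close>. Once all vertices are present, the
  equal excess forces all edges to be present.\<close>

lemma card_colorings_grow:
  assumes G: "simple_graph G" "connected_graph G" and C: "finite C"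
    and "finite V" "V \<noteq> {}" "V \<subseteq> verts G" "E \<subseteq> edges G" "\<And>e. e \<in> E \<Longrightarrow> e \<subseteq> V"
    and "card (edges G) + card V = card E + card (verts G)"
  shows "card (colorings C (verts G) (edges G))
    = card (colorings C V E) * (card C - 1) ^ (card (verts G) - card V)"
  using assms(4-9)
proof (induction "card (verts G) - card V" arbitrary: V E)
  case 0
  have fin: "finite (verts G)" "finite (edges G)"
    using G(1) finite_subset[of "edges G" "Pow (verts G)"] by (auto simp: simple_graph_def)
  have "V = verts G"
    using 0 fin by (intro card_subset_eq) (auto dest: card_mono)
  moreover have "E = edges G"
    using 0 fin \<open>V = verts G\<close> by (intro card_subset_eq) auto
  ultimately show ?case
    by simp
next
  case (Suc d)
  obtain a where a: "a \<in> V"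
    using Suc.prems by auto
  have "V \<noteq> verts G"
    using Suc.hyps by auto
  then obtain b where b: "b \<in> verts G" "b \<notin> V"
    using Suc.prems by auto
  have "(a, b) \<in> {(x, y). {x, y} \<in> edges G}\<^sup>*"
    using a b G(2) Suc.prems unfolding connected_graph_def by blast
  then have "\<exists>u x. {u, x} \<in> edges G \<and> u \<in> V \<and> x \<notin> V"
    using b(2)
  proof (induction rule: rtrancl_induct)
    case base
    then show ?case
      using a by simp
  next
    case (step y z)
    then show ?case
      by (cases "y \<in> V") auto
  qed
  then obtain u x where ux: "{u, x} \<in> edges G" "u \<in> V" "x \<notin> V"
    by blast
  have x: "x \<in> verts G"
    using ux G(1) by (auto simp: simple_graph_def)
  have "finite E"
    using Suc.prems finite_subset[of E "Pow V"] by auto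
  moreover have "{u, x} \<notin> E"
    using Suc.prems(5) ux by blast
  ultimately have "card (edges G) + card (insert x V) = card (insert {u, x} E) + card (verts G)"
    using Suc.prems ux by simp
  moreover have "d = card (verts G) - card (insert x V)"
    using Suc.hyps(2) Suc.prems(1) ux(3) by simp
  moreover have "e \<subseteq> insert x V" if "e \<in> insert {u, x} E" for e
    using that Suc.prems(5) ux by blast
  ultimately have "card (colorings C (verts G) (edges G))
      = card (colorings C (insert x V) (insert {u, x} E)) * (card C - 1) ^ d"
    using Suc.hyps(1)[of "insert x V" "insert {u, x} E"] Suc.prems ux x by simp
  also have "\<dots> = card (colorings C V E) * (card C - 1) ^ Suc d"
    using card_colorings_add_leaf[OF C Suc.prems(1) ux(3,2) Suc.prems(5)] by simp
  finally show ?case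
    using Suc.hyps(2) by simp
qed

section \<open>Paths, ears and theta graphs\<close>

text \<open>
  \<open>walks C n a b\<close> counts the colourings of the \<open>n\<close> internal vertices of a path whose ends are
  coloured \<open>a\<close> and \<open>b\<close>.
\<close>

primrec walks :: "nat set \<Rightarrow> nat \<Rightarrow> nat \<Rightarrow> nat \<Rightarrow> nat" where
  "walks C 0 a b = (if a = b then 0 else 1)"
| "walks C (Suc n) a b = (\<Sum>c\<in>C - {a}. walks C n c b)"

text \<open>The transition matrix of colours, all ones minus the identity, has eigenvalues
  \<open>r\<close> and -1, and \<open>x\<close> is their quotient -1/\<open>r\<close>. The factor
  \<open>1 - x\<close> on the left clears the denominator.\<close>

lemma walks_closed_form:
  fixes r x :: "'a::field_char_0"
  assumes "finite C" "r = of_nat (card C) - 1" "r * x = - 1" "a \<in> C" "b \<in> C"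
  shows "of_nat (walks C n a b) * (1 - x) = r ^ n * (1 - x ^ (if a = b then n else Suc n))"
  using assms(4)
proof (induction n arbitrary: a)
  case 0
  then show ?case by simp
next
  case (Suc n)
  have card: "of_nat (card (C - {a})) = r"
  proof -
    have "card C = Suc (card (C - {a}))"
      using Suc.prems assms(1) by (rule card.remove[rotated])
    then show ?thesis
      using assms(2) by simp
  qed
  have "of_nat (walks C (Suc n) a b) * (1 - x)
      = (\<Sum>c\<in>C - {a}. r ^ n * (1 - x ^ (if c = b then n else Suc n)))"
    using Suc.IH by (simp add: sum_distrib_right)
  also have "\<dots> = r ^ Suc n * (1 - x ^ (if a = b then Suc n else Suc (Suc n)))"
  proof (cases "a = b")
    case True
    then show ?thesis
      using card by simp
  next
    case False
    have rx: "r * (x * z) = - z" for z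
      using assms(3) by (simp flip: mult.assoc)
    \<comment> \<open>The colour \<open>b\<close> occurs once in \<open>C - {a}\<close>; all terms
      are given the generic value and \<open>b\<close> gets a correction.\<close>
    have "(\<Sum>c\<in>C - {a}. r ^ n * (1 - x ^ (if c = b then n else Suc n)))
        = (\<Sum>c\<in>C - {a}. r ^ n * (1 - x ^ Suc n) + (if c = b then r ^ n * (x ^ Suc n - x ^ n) else 0))"
      by (intro sum.cong) (auto simp: algebra_simps)
    also have "\<dots> = r * (r ^ n * (1 - x ^ Suc n)) + r ^ n * (x ^ Suc n - x ^ n)"
      using False assms(1,5) card by (simp add: sum.distrib)
    also have "\<dots> = r ^ Suc n * (1 - x ^ Suc (Suc n))"
      by (simp add: algebra_simps rx)
    finally show ?thesis
      using False by simp
  qed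
  finally show ?case .
qed

lemma path_edges_Cons: "path_edges (a # b # ys) = insert {a, b} (path_edges (b # ys))"
proof -
  have "path_edges (a # b # ys) = (\<lambda>i. {(a # b # ys) ! i, (b # ys) ! i}) ` {..<Suc (length ys)}"
    by (auto simp: path_edges_def)
  also have "\<dots> = insert {a, b} ((\<lambda>i. {(b # ys) ! i, ys ! i}) ` {..<length ys})"
    by (simp add: lessThan_Suc_eq_insert_0 image_image)
  also have "(\<lambda>i. {(b # ys) ! i, ys ! i}) ` {..<length ys} = path_edges (b # ys)"
    by (auto simp: path_edges_def)
  finally show ?thesis .
qed

lemma path_edges_subset: "e \<in> path_edges p \<Longrightarrow> e \<subseteq> set p"
  by (auto simp: path_edges_def)

text \<open>The list \<open>xs\<close> holds the internal vertices of the ear. In the induction its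
  start \<open>u\<close> moves along the ear while \<open>a\<close> stays fixed; keeping the weight
  \<open>g\<close> general lets several ears be attached in succession.\<close>

lemma sum_colorings_ear:
  fixes g :: "nat \<Rightarrow> nat \<Rightarrow> nat"
  assumes "finite C" "v \<in> V" "a \<in> V" "u \<in> V"
    and "finite V" "\<And>e. e \<in> E \<Longrightarrow> e \<subseteq> V" "distinct xs" "set xs \<inter> V = {}"
  shows "(\<Sum>\<kappa>\<in>colorings C (V \<union> set xs) (E \<union> path_edges (u # xs @ [v])). g (\<kappa> a) (\<kappa> v))
    = (\<Sum>\<kappa>\<in>colorings C V E. g (\<kappa> a) (\<kappa> v) * walks C (length xs) (\<kappa> u) (\<kappa> v))"
  using assms(2-)
proof (induction xs arbitrary: u V E g)
  case Nil
  \<comment> \<open>An ear without internal vertices is a single edge, and \<open>walks C 0\<close>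
    is the indicator of different end colours.\<close>
  have "colorings C V (insert {u, v} E) = {\<kappa> \<in> colorings C V E. \<kappa> u \<noteq> \<kappa> v}"
    by (auto simp: colorings_def doubleton_eq_iff)
  moreover have "path_edges [u, v] = {{u, v}}"
    by (auto simp: path_edges_def less_Suc_eq)
  ultimately show ?case
    using Nil assms(1) by (auto simp: sum.inter_filter finite_colorings intro!: sum.cong)
next
  case (Cons x xs)
  let ?V = "insert x V" and ?E = "E \<union> (\<lambda>u. {u, x}) ` {u}"
  have x: "x \<notin> V"
    using Cons.prems by simp
  then have ne: "a \<noteq> x" "v \<noteq> x"
    using Cons.prems by auto
  have sub: "e \<subseteq> ?V" if "e \<in> ?E" for e
    using that Cons.prems(3,5) by blast
  have "V \<union> set (x # xs) = ?V \<union> set xs"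
    "E \<union> path_edges (u # (x # xs) @ [v]) = ?E \<union> path_edges (x # xs @ [v])"
    by (auto simp: path_edges_Cons)
  then have "(\<Sum>\<kappa>\<in>colorings C (V \<union> set (x # xs)) (E \<union> path_edges (u # (x # xs) @ [v])). g (\<kappa> a) (\<kappa> v))
      = (\<Sum>\<kappa>\<in>colorings C ?V ?E. g (\<kappa> a) (\<kappa> v) * walks C (length xs) (\<kappa> x) (\<kappa> v))"
    using Cons.IH[of ?V x ?E g] Cons.prems sub by auto
  \<comment> \<open>Summing over the colour of \<open>x\<close> reproduces the recursion of
    \<open>walks\<close>; the weight is unaffected because \<open>a\<close> and \<open>v\<close>
    differ from \<open>x\<close>.\<close>
  also have "\<dots> = (\<Sum>\<kappa>\<in>colorings C V E. \<Sum>c\<in>C - {\<kappa> u}.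
      g (\<kappa> a) (\<kappa> v) * walks C (length xs) c (\<kappa> v))"
    using sum_colorings_insert[of C V x "{u}" E
        "\<lambda>\<kappa>. g (\<kappa> a) (\<kappa> v) * walks C (length xs) (\<kappa> x) (\<kappa> v)"] Cons.prems x ne assms(1)
    by simp
  finally show ?case
    by (simp add: sum_distrib_left)
qed

lemma sum_colorings_no_edges:
  assumes "finite C" "u \<noteq> v"
  shows "(\<Sum>\<kappa>\<in>colorings C {u, v} {}. g (\<kappa> u) (\<kappa> v)) = (\<Sum>a\<in>C. \<Sum>b\<in>C. g a b)"
proof -
  have "colorings C ({} :: 'a set) {} = {\<lambda>_. undefined}"
    by (simp add: colorings_def)
  then show ?thesis
    using sum_colorings_insert[of C "{v}" u "{}" "{}" "\<lambda>\<kappa>. g (\<kappa> u) (\<kappa> v)"]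
      sum_colorings_insert[of C "{}" v "{}" "{}" "\<lambda>\<kappa>. \<Sum>c\<in>C. g c (\<kappa> v)"] assms
      sum.swap[of "\<lambda>b a. g a b" C C]
    by simp
qed

lemma path_with_ends:
  assumes "distinct p" "length p = k + 1" "hd p = u" "last p = v" "k \<ge> 1"
  obtains ps where "p = u # ps @ [v]" "length ps = k - 1" "distinct ps" "set ps \<inter> {u, v} = {}" "u \<noteq> v"
proof -
  obtain p' where p': "p = u # p'" "p' \<noteq> []"
    using assms by (cases p) (auto split: if_splits)
  then have "p = u # butlast p' @ [v]"
    using assms(4) append_butlast_last_id[of p'] by simp
  then obtain ps where ps: "p = u # ps @ [v]"
    by blast
  show thesis
    using that[OF ps] ps assms by auto
qed

text \<open>The graph is built from the two isolated branch vertices by attaching the three paths as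
  ears. A path with \<open>k\<close> edges has \<open>k - 1\<close> internal vertices, possibly
  none.\<close>

lemma theta_graph_colorings:
  assumes "theta_graph k l m H" "finite C"
  shows "card (verts H) + 1 = k + l + m"
    and "card (colorings C (verts H) (edges H))
      = (\<Sum>a\<in>C. \<Sum>b\<in>C. walks C (k - 1) a b * walks C (l - 1) a b * walks C (m - 1) a b)"
proof -
  have pos: "k \<ge> 1" "l \<ge> 1" "m \<ge> 1"
    using assms by (auto simp: theta_graph_def)
  obtain u v p q r where
    p: "distinct p" "length p = k + 1" "hd p = u" "last p = v" and
    q: "distinct q" "length q = l + 1" "hd q = u" "last q = v" and
    r: "distinct r" "length r = m + 1" "hd r = u" "last r = v" and
    inter: "set p \<inter> set q = {u, v}" "set p \<inter> set r = {u, v}" "set q \<inter> set r = {u, v}" and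
    H: "verts H = set p \<union> set q \<union> set r" "edges H = path_edges p \<union> path_edges q \<union> path_edges r"
    using assms unfolding theta_graph_def by blast
  obtain ps where ps: "p = u # ps @ [v]" "length ps = k - 1" "distinct ps" "set ps \<inter> {u, v} = {}" "u \<noteq> v"
    by (rule path_with_ends[OF p pos(1)])
  obtain qs where qs: "q = u # qs @ [v]" "length qs = l - 1" "distinct qs" "set qs \<inter> {u, v} = {}"
    by (rule path_with_ends[OF q pos(2)])
  obtain rs where rs: "r = u # rs @ [v]" "length rs = m - 1" "distinct rs" "set rs \<inter> {u, v} = {}"
    by (rule path_with_ends[OF r pos(3)])
  let ?V0 = "{u, v}" and ?E0 = "{} :: 'a set set"
  let ?V1 = "?V0 \<union> set ps" and ?E1 = "?E0 \<union> path_edges p"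
  let ?V2 = "?V1 \<union> set qs" and ?E2 = "?E1 \<union> path_edges q"
  let ?V3 = "?V2 \<union> set rs" and ?E3 = "?E2 \<union> path_edges r"
  have V: "verts H = ?V3" and E: "edges H = ?E3"
    using H ps qs rs by auto
  have disj: "set ps \<inter> set qs = {}" "set ps \<inter> set rs = {}" "set qs \<inter> set rs = {}"
    using inter ps qs rs by auto
  then have "card ?V3 = 2 + (k - 1) + (l - 1) + (m - 1)"
    using ps qs rs
    by (subst card_Un_disjoint; auto simp: distinct_card)+
  then show "card (verts H) + 1 = k + l + m"
    using V pos by simp
  have disj': "set qs \<inter> ?V1 = {}" "set rs \<inter> ?V2 = {}"
    using disj qs(4) rs(4) by blast+
  have E1: "e \<subseteq> ?V1" if "e \<in> ?E1" for e
    using that path_edges_subset[of e p] ps by auto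
  have E2: "e \<subseteq> ?V2" if "e \<in> ?E2" for e
    using that path_edges_subset[of e q] qs E1[of e] by auto
  have "card (colorings C (verts H) (edges H)) = (\<Sum>\<kappa>\<in>colorings C ?V3 ?E3. 1)"
    by (simp add: V E)
  also have "\<dots> = (\<Sum>\<kappa>\<in>colorings C ?V2 ?E2. walks C (m - 1) (\<kappa> u) (\<kappa> v))"
    using sum_colorings_ear[of C v ?V2 u u ?E2 rs "\<lambda>_ _. 1"] E2 rs disj' assms(2) by auto
  also have "\<dots> = (\<Sum>\<kappa>\<in>colorings C ?V1 ?E1.
      walks C (m - 1) (\<kappa> u) (\<kappa> v) * walks C (l - 1) (\<kappa> u) (\<kappa> v))"
    using sum_colorings_ear[of C v ?V1 u u ?E1 qs "walks C (m - 1)"] E1 qs disj' assms(2) by auto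
  also have "\<dots> = (\<Sum>\<kappa>\<in>colorings C ?V0 ?E0.
      walks C (m - 1) (\<kappa> u) (\<kappa> v) * walks C (l - 1) (\<kappa> u) (\<kappa> v) * walks C (k - 1) (\<kappa> u) (\<kappa> v))"
    using sum_colorings_ear[of C v ?V0 u u ?E0 ps "\<lambda>a b. walks C (m - 1) a b * walks C (l - 1) a b"]
      ps assms(2) by auto
  also have "\<dots> = (\<Sum>a\<in>C. \<Sum>b\<in>C. walks C (m - 1) a b * walks C (l - 1) a b * walks C (k - 1) a b)"
    using sum_colorings_no_edges[OF assms(2) ps(5),
        of "\<lambda>a b. walks C (m - 1) a b * walks C (l - 1) a b * walks C (k - 1) a b"] .
  finally show "card (colorings C (verts H) (edges H))
      = (\<Sum>a\<in>C. \<Sum>b\<in>C. walks C (k - 1) a b * walks C (l - 1) a b * walks C (m - 1) a b)"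
    by (simp add: ac_simps)
qed

section \<open>Binomial identities\<close>

lemma hockey_stick: "(a + d) choose Suc j = (a choose Suc j) + (\<Sum>i<d. (a + i) choose j)"
  by (induction d) simp_all

text \<open>The last step, from b-1 to b, already adds the binomial coefficient (b-1 choose j-1),
  which is positive for j <= b.\<close>

lemma binomial_strict_right_mono:
  assumes "a < b" "1 \<le> j" "j \<le> b"
  shows "a choose j < b choose j"
proof -
  obtain b' j' where b: "b = Suc b'" "j = Suc j'"
    using assms by (cases b; cases j) auto
  have "a choose j \<le> b' choose j"
    using assms b by (intro binomial_right_mono) auto
  also have "\<dots> < b choose j"
    using assms b by simp
  finally show ?thesis .
qed

text \<open>Each large binomial on the right exceeds one on the left by a hockey-stick sum, of l-1
  and of k terms. The remaining binomial (k+l-1 choose j+1) splits into l-1 and k terms as well, and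
  these are compared one by one.\<close>

lemma theta_binomial_less:
  assumes "k \<ge> 1" "l \<ge> 1" "m \<ge> 1" "1 \<le> j" "j + 2 \<le> k + l + m"
  shows "((k + l - 1) choose Suc j) + ((k + m - 1) choose Suc j) + ((l + m - 1) choose Suc j)
    < ((k + l + m - 2) choose Suc j) + ((k + l + m - 1) choose Suc j)"
proof -
  obtain k' l' where kl: "k = Suc k'" "l = Suc l'"
    using assms by (cases k; cases l) auto
  have "(k + l - 1) choose Suc j = (l' + k) choose Suc j"
    by (simp add: kl add.commute)
  also have "\<dots> = (l' choose Suc j) + (\<Sum>i<k. (l' + i) choose j)"
    by (rule hockey_stick)
  also have "l' choose Suc j = (\<Sum>i<l'. i choose j)"
    using hockey_stick[of 0 l' j] by simp
  finally have 1: "(k + l - 1) choose Suc j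
      = (\<Sum>i<l'. i choose j) + (\<Sum>i<k'. (l' + i) choose j) + ((l' + k') choose j)"
    by (simp add: kl)
  have 2: "(k + l + m - 2) choose Suc j = ((k + m - 1) choose Suc j) + (\<Sum>i<l'. (k + m - 1 + i) choose j)"
    using hockey_stick[of "k + m - 1" l' j] by (simp add: kl ac_simps)
  have 3: "(k + l + m - 1) choose Suc j = ((l + m - 1) choose Suc j)
      + (\<Sum>i<k'. (l + m - 1 + i) choose j) + ((l + m - 1 + k') choose j)"
    using hockey_stick[of "l + m - 1" k j] assms by (simp add: kl ac_simps)
  have "(\<Sum>i<l'. i choose j) \<le> (\<Sum>i<l'. (k + m - 1 + i) choose j)"
    by (intro sum_mono binomial_right_mono) auto
  moreover have "(\<Sum>i<k'. (l' + i) choose j) \<le> (\<Sum>i<k'. (l + m - 1 + i) choose j)"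
    using assms kl by (intro sum_mono binomial_right_mono) auto
  \<comment> \<open>Strictness comes from this last pair alone: its larger upper index is k+l+m-2,
    at least \<open>j\<close> by hypothesis.\<close>
  moreover have "(l' + k') choose j < (l + m - 1 + k') choose j"
    using assms kl by (intro binomial_strict_right_mono) auto
  ultimately show ?thesis
    unfolding 1 2 3 by linarith
qed

text \<open>This form is symmetric in the three path lengths; up to sign it is the coefficient of
  y^(j+1) in \<open>theta_numerator\<close> at x = 1 - y.\<close>

definition theta_bracket :: "nat \<Rightarrow> nat \<Rightarrow> nat \<Rightarrow> nat \<Rightarrow> rat" where
  "theta_bracket k l m j = of_nat ((k + l + m - 2) choose Suc j) + of_nat ((k + l + m - 1) choose Suc j)
     - of_nat ((k + l - 1) choose Suc j) - of_nat ((k + m - 1) choose Suc j)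
     - of_nat ((l + m - 1) choose Suc j)"

lemma type_II_formula_eq_bracket:
  assumes "k \<ge> 1" "m \<ge> 1"
  shows "type_II_formula (l + k) (l + m) l j = (-1) ^ (j - 1) * theta_bracket k l m j"
proof -
  have "(k + l + m - 1) choose Suc j
      = ((k + m - 1) choose Suc j) + (\<Sum>i<l. (k + m - 1 + i) choose j)"
    using hockey_stick[of "k + m - 1" l j] assms by (simp add: ac_simps)
  \<comment> \<open>The index shifts by one: the upper index on the right is k+m-2+i with i starting
    at 1, and k, m >= 1 prevent truncation.\<close>
  also have "(\<Sum>i<l. (k + m - 1 + i) choose j)
      = (\<Sum>i = 1..l. ((l + k) + (l + m) - 2 * (l + 1) + i) choose j)"
    unfolding One_nat_def sum.atLeast1_atMost_eq using assms by (intro sum.cong) (auto intro!: arg_cong2[of _ _ _ _ binomial])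
  finally have "of_nat ((k + l + m - 1) choose Suc j)
      = (of_nat ((k + m - 1) choose Suc j) :: rat)
        + (\<Sum>i = 1..l. of_nat (((l + k) + (l + m) - 2 * (l + 1) + i) choose j))"
    by simp
  moreover have "(l + k) + (l + m) - l - 2 = k + l + m - 2"
    by simp
  ultimately show ?thesis
    unfolding type_II_formula_def theta_bracket_def by (simp add: ac_simps)
qed

text \<open>For \<open>l = 0\<close> the inner sum is empty; for \<open>l = 1\<close> its only term
  merges with the next binomial by Pascal's rule.\<close>

lemma type_II_formula_zero_one:
  assumes "s + t \<ge> 4" "l \<in> {0, 1}"
  shows "type_II_formula s t l j = (-1) ^ (j - 1) * (of_nat ((s + t - 2) choose (j + 1))
    - of_nat ((s - 1) choose (j + 1)) - of_nat ((t - 1) choose (j + 1)))"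
proof (cases "l = 0")
  case True
  then show ?thesis
    by (simp add: type_II_formula_def)
next
  case False
  have "(s + t - 2) choose Suc j = ((s + t - 3) choose j) + ((s + t - 3) choose Suc j)"
  proof -
    have "s + t - 2 = Suc (s + t - 3)"
      using assms by simp
    then show ?thesis
      by (simp only: binomial_Suc_Suc)
  qed
  moreover have "s + t - 4 + 1 = s + t - 3"
    using assms by simp
  moreover have "s + t - 1 - 2 = s + t - 3"
    by simp
  moreover have "l = 1"
    using False assms(2) by simp
  ultimately show ?thesis
    by (simp add: type_II_formula_def del: diff_diff_left)
qed

text \<open>The two products on the left come from branch vertices with different and with equal
  colours; their combination is divisible by \<open>1 - x\<close>.\<close>

lemma theta_power_identity:
  fixes x :: "'a::comm_ring_1"
  assumes "k \<ge> 1" "l \<ge> 1" "m \<ge> 1"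
  shows "(1 - x ^ k) * (1 - x ^ l) * (1 - x ^ m)
      - x * ((1 - x ^ (k - 1)) * (1 - x ^ (l - 1)) * (1 - x ^ (m - 1)))
    = (1 - x) * (1 - x ^ (k + l - 1) - x ^ (k + m - 1) - x ^ (l + m - 1)
      + x ^ (k + l + m - 2) + x ^ (k + l + m - 1))"
proof -
  obtain k' l' m' where "k = Suc k'" "l = Suc l'" "m = Suc m'"
    using assms by (cases k; cases l; cases m) auto
  then show ?thesis
    by (simp add: power_add algebra_simps)
qed

lemma coeff_one_minus_X_power:
  "coeff ([:1, -1:] ^ e) i = (-1) ^ i * (of_nat (e choose i) :: 'a::comm_ring_1)"
proof (cases "i \<le> e")
  case True
  then show ?thesis
    by (simp add: coeff_linear_poly_power)
next
  case False
  have "degree ([:1, -1 :: 'a:] ^ e) \<le> e"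
    using degree_power_le[of "[:1, -1 :: 'a:]" e] by simp
  then have "coeff ([:1, -1 :: 'a:] ^ e) i = 0"
    using False by (intro coeff_eq_0) simp
  then show ?thesis
    using False by (simp add: binomial_eq_0)
qed

section \<open>Colourings of type-II graphs and the star expansion\<close>

text \<open>Defined over any commutative ring so that it can be evaluated at a number and at the
  polynomial \<open>[:1, -1:]\<close>, that is 1 - y.\<close>

definition theta_numerator :: "nat \<Rightarrow> nat \<Rightarrow> nat \<Rightarrow> 'a::comm_ring_1 \<Rightarrow> 'a" where
  "theta_numerator k l m x = 1 - x ^ (k + l - 1) - x ^ (k + m - 1) - x ^ (l + m - 1)
     + x ^ (k + l + m - 2) + x ^ (k + l + m - 1)"

lemma theta_graph_colorings_value:
  fixes r x :: "'a::field_char_0"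
  assumes theta: "theta_graph k l m H" and "finite C" "card C \<ge> 1" and r: "r = of_nat (card C) - 1" "r * x = - 1"
  shows "of_nat (card (colorings C (verts H) (edges H))) * (1 - x)
    = r ^ card (verts H) * theta_numerator k l m x"
proof -
  have pos: "k \<ge> 1" "l \<ge> 1" "m \<ge> 1"
    using theta by (auto simp: theta_graph_def)
  have q: "of_nat (card C) = r * (1 - x)"
    using r by (simp add: algebra_simps)
  let ?R = "r ^ (k - 1) * r ^ (l - 1) * r ^ (m - 1)"
  let ?X = "?R * ((1 - x ^ (k - 1)) * (1 - x ^ (l - 1)) * (1 - x ^ (m - 1)))"
  let ?Y = "?R * ((1 - x ^ k) * (1 - x ^ l) * (1 - x ^ m))"
  have w: "of_nat (walks C (i - 1) a b) * (1 - x) = r ^ (i - 1) * (1 - x ^ (if a = b then i - 1 else i))"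
    if "a \<in> C" "b \<in> C" "i \<ge> 1" for a b i
    using walks_closed_form[OF \<open>finite C\<close> r that(1,2), of "i - 1"] that(3) by simp
  have summand: "of_nat (walks C (k - 1) a b * walks C (l - 1) a b * walks C (m - 1) a b) * (1 - x) ^ 3
      = (if a = b then ?X else ?Y)" (is "?L = _") if "a \<in> C" "b \<in> C" for a b
  proof -
    have "?L = (of_nat (walks C (k - 1) a b) * (1 - x)) * (of_nat (walks C (l - 1) a b) * (1 - x))
        * (of_nat (walks C (m - 1) a b) * (1 - x))"
      by (simp add: power3_eq_cube ac_simps)
    also have "\<dots> = (if a = b then ?X else ?Y)"
      unfolding w[OF that pos(1)] w[OF that pos(2)] w[OF that pos(3)] by (simp add: ac_simps)
    finally show ?thesis .
  qed
  \<comment> \<open>For fixed \<open>a\<close> there is one equal colour \<open>b\<close> and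
    \<open>r\<close> different ones.\<close>
  have row: "(\<Sum>b\<in>C. if a = b then X else Y) = X + r * Y" if "a \<in> C" for a and X Y :: 'a
  proof -
    have "(\<Sum>b\<in>C. if a = b then X else Y) = (\<Sum>b\<in>C. Y + (if a = b then X - Y else 0))"
      by (intro sum.cong) auto
    also have "\<dots> = of_nat (card C) * Y + (X - Y)"
      using that \<open>finite C\<close> by (simp add: sum.distrib)
    also have "\<dots> = X + r * Y"
      unfolding r(1) by (simp add: algebra_simps)
    finally show ?thesis .
  qed
  have regroup: "r * (1 - x) * ((- r * x) * (R * X) + r * (R * Y)) = r * r * R * (1 - x) * (Y - x * X)"
    for R X Y :: 'a
    by (simp add: algebra_simps)
  \<comment> \<open>The cube supplies one factor \<open>1 - x\<close> for the closed form of each of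
    the three paths.\<close>
  have "of_nat (card (colorings C (verts H) (edges H))) * (1 - x) ^ 3
      = (\<Sum>a\<in>C. \<Sum>b\<in>C. of_nat (walks C (k - 1) a b * walks C (l - 1) a b * walks C (m - 1) a b) * (1 - x) ^ 3)"
    by (simp add: theta_graph_colorings(2)[OF theta \<open>finite C\<close>] sum_distrib_right)
  also have "\<dots> = (\<Sum>a\<in>C. ?X + r * ?Y)"
    using summand row by simp
  also have "\<dots> = r * (1 - x) * (?X + r * ?Y)"
    by (simp add: q)
  \<comment> \<open>Writing 1 as \<open>- r * x\<close> makes \<open>r\<close> a common factor,
    leaving the left side of \<open>theta_power_identity\<close>.\<close>
  also have "\<dots> = r * (1 - x) * ((- r * x) * ?X + r * ?Y)"
    using r(2) by simp
  also have "\<dots> = r * r * ?R * (1 - x)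
      * ((1 - x ^ k) * (1 - x ^ l) * (1 - x ^ m)
        - x * ((1 - x ^ (k - 1)) * (1 - x ^ (l - 1)) * (1 - x ^ (m - 1))))"
    by (rule regroup)
  also have "\<dots> = r * r * ?R * theta_numerator k l m x * (1 - x) ^ 2"
    unfolding theta_power_identity[OF pos] by (simp add: theta_numerator_def power2_eq_square ac_simps)
  also have "r * r * ?R = r ^ card (verts H)"
  proof -
    have "card (verts H) = 2 + (k - 1) + (l - 1) + (m - 1)"
      using theta_graph_colorings(1)[OF theta \<open>finite C\<close>] pos by simp
    then show ?thesis
      by (simp add: power_add power2_eq_square ac_simps)
  qed
  finally have "(of_nat (card (colorings C (verts H) (edges H))) * (1 - x)) * (1 - x) ^ 2
      = (r ^ card (verts H) * theta_numerator k l m x) * (1 - x) ^ 2"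
    by (simp add: power2_eq_square power3_eq_cube ac_simps)
  moreover have "1 - x \<noteq> 0"
  proof
    assume "1 - x = 0"
    then have "of_nat (card C) = (0 :: 'a)"
      using q by simp
    then show False
      using \<open>card C \<ge> 1\<close> by simp
  qed
  ultimately show ?thesis
    by simp
qed

text \<open>\<open>G\<close> and its theta subgraph are both bicyclic, so they have the same excess
  of edges over vertices and \<open>card_colorings_grow\<close> applies; every added vertex
  contributes one factor \<open>r\<close>.\<close>

lemma type_II_bicyclic_colorings_value:
  fixes r x :: "'a::field_char_0"
  assumes G: "type_II_bicyclic k l m G" and C: "finite C" "card C \<ge> 1"
    and r: "r = of_nat (card C) - 1" "r * x = - 1"
  shows "of_nat (card (colorings C (verts G) (edges G))) * (1 - x)
    = r ^ card (verts G) * theta_numerator k l m x"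
proof -
  obtain H where H: "minimal_bicyclic_subgraph H G" "theta_graph k l m H" and bi: "bicyclic G"
    using G by (auto simp: type_II_bicyclic_def)
  have sub: "verts H \<subseteq> verts G" "edges H \<subseteq> edges G" and simpleH: "simple_graph H"
    and biH: "bicyclic H"
    using H(1) by (auto simp: minimal_bicyclic_subgraph_def subgraph_def)
  have le: "card (verts H) \<le> card (verts G)"
    using sub bi by (intro card_mono) (auto simp: bicyclic_def simple_graph_def)
  have "card (colorings C (verts G) (edges G))
      = card (colorings C (verts H) (edges H)) * (card C - 1) ^ (card (verts G) - card (verts H))"
    using bi biH simpleH sub C(1)
    by (intro card_colorings_grow) (auto simp: bicyclic_def simple_graph_def connected_graph_def)
  then have "of_nat (card (colorings C (verts G) (edges G))) * (1 - x)
      = (of_nat (card (colorings C (verts H) (edges H))) * (1 - x)) * r ^ (card (verts G) - card (verts H))"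
    using C(2) r(1) by (simp add: of_nat_diff mult_ac)
  also have "\<dots> = r ^ (card (verts H) + (card (verts G) - card (verts H))) * theta_numerator k l m x"
    unfolding theta_graph_colorings_value[OF H(2) C r] by (simp add: power_add mult_ac)
  finally show ?thesis
    using le by simp
qed

section \<open>Comparison with the star expansion\<close>

lemma star_expansion_colorings:
  assumes G: "chromatic_sym G = (\<Sum>lam\<in>partitions n. mps_scale (c lam) (star_prod lam))"
    and "finite (verts G)" "card (verts G) = n" "N \<ge> 2"
  shows "of_nat (card (colorings {..<N} (verts G) (edges G)))
    = of_nat (N - 1) ^ n * (\<Sum>lam\<in>partitions n. c lam * (of_nat N / of_nat (N - 1)) ^ size lam)"
proof -
  have "of_nat (card (colorings {..<N} (verts G) (edges G))) = ones_eval N n (chromatic_sym G)"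
    using ones_eval_chromatic_sym[of G N] assms by simp
  also have "\<dots> = (\<Sum>lam\<in>partitions n. c lam * ones_eval N n (star_prod lam))"
    by (simp add: G ones_eval_sum ones_eval_scale)
  also have "\<dots> = (\<Sum>lam\<in>partitions n. of_nat (N - 1) ^ n * (c lam * (of_nat N / of_nat (N - 1)) ^ size lam))"
  proof (rule sum.cong)
    fix lam assume "lam \<in> partitions n"
    then have "ones_eval N n (star_prod lam) = (of_nat N / of_nat (N - 1)) ^ size lam * of_nat (N - 1) ^ n"
      using star_prod_homogeneous_eval(2)[of lam N] assms(4) by (simp add: partitions_def)
    then show "c lam * ones_eval N n (star_prod lam)
        = of_nat (N - 1) ^ n * (c lam * (of_nat N / of_nat (N - 1)) ^ size lam)"
      by simp
  qed simp
  finally show ?thesis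
    by (simp add: sum_distrib_left)
qed

lemma type_II_star_coefficients:
  assumes G: "type_II_bicyclic k l m G" and n: "card (verts G) = n"
    and c: "chromatic_sym G = (\<Sum>lam\<in>partitions n. mps_scale (c lam) (star_prod lam))"
    and j: "j \<ge> 1"
  shows "(\<Sum>lam\<in>{lam \<in> partitions n. size lam = j}. c lam) = (-1) ^ (j - 1) * theta_bracket k l m j"
proof -
  have fin: "finite (verts G)"
    using G by (auto simp: type_II_bicyclic_def bicyclic_def simple_graph_def)
  \<comment> \<open>The coefficient of \<open>P\<close> at \<open>j\<close> collects the star
    coefficients of the partitions with \<open>j\<close> parts.\<close>
  define P where "P = (\<Sum>lam\<in>partitions n. monom (c lam) (size lam))"
  define Q where "Q = theta_numerator k l m [:1, -1 :: rat:]"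
  \<comment> \<open>This is N/(N-1) at N = i+2, which keeps the denominator non-zero.\<close>
  define y where "y i = (of_nat (i + 2) / of_nat (i + 1) :: rat)" for i :: nat
  have "poly (pCons 0 P) (y i) = poly Q (y i)" for i
  proof -
    let ?r = "of_nat (i + 1) :: rat"
    have x: "?r * (1 - y i) = - 1"
      by (simp add: y_def field_simps)
    have "of_nat (card (colorings {..<i + 2} (verts G) (edges G))) * (1 - (1 - y i))
        = ?r ^ card (verts G) * theta_numerator k l m (1 - y i)"
      using x by (intro type_II_bicyclic_colorings_value[OF G]) auto
    moreover have "of_nat (card (colorings {..<i + 2} (verts G) (edges G))) = ?r ^ n * poly P (y i)"
      using star_expansion_colorings[OF c fin n, of "i + 2"]
      by (simp add: P_def poly_sum poly_monom y_def)
    ultimately have "?r ^ n * (y i * poly P (y i)) = ?r ^ n * theta_numerator k l m (1 - y i)"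
      using n by (simp add: mult_ac)
    then have "y i * poly P (y i) = theta_numerator k l m (1 - y i)"
      by simp
    then show ?thesis
      by (simp add: Q_def theta_numerator_def)
  qed
  then have "range y \<subseteq> {z. poly (pCons 0 P - Q) z = 0}"
    by auto
  moreover have "infinite (range y)"
  proof (rule range_inj_infinite)
    have "y i = 1 + 1 / of_nat (i + 1)" for i
      by (simp add: y_def field_simps)
    then show "inj y"
      by (intro injI) simp
  qed
  ultimately have "pCons 0 P - Q = 0"
    using poly_roots_finite finite_subset by blast
  \<comment> \<open>\<open>pCons 0 P\<close> is y times \<open>P\<close>, which explains the lower
    index j+1 in the binomials.\<close>
  then have "coeff P j = coeff Q (Suc j)"
    by (metis coeff_pCons_Suc eq_iff_diff_eq_0)
  also have "coeff Q (Suc j) = (-1) ^ Suc j * theta_bracket k l m j"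
    by (simp add: Q_def theta_numerator_def theta_bracket_def coeff_one_minus_X_power algebra_simps)
  also have "(-1) ^ Suc j = ((-1) ^ (j - 1) :: rat)"
    using j by (cases j) auto
  also have "coeff P j = (\<Sum>lam\<in>{lam \<in> partitions n. size lam = j}. c lam)"
    by (simp add: P_def coeff_sum sum.inter_filter finite_partitions)
  finally show ?thesis .
qed

theorem proposition7p5:
  fixes G :: "'a sgraph" and c :: "nat multiset \<Rightarrow> rat" and n k l m s t :: nat
  assumes "type_II_bicyclic k l m G"
    and "s = l + k" and "t = l + m"
    and "s \<ge> 3" and "t \<ge> 3" and "l \<ge> 1"
    and "card (verts G) = n"
    and "chromatic_sym G = (\<Sum>lam\<in>partitions n. mps_scale (c lam) (star_prod lam))"
  shows "\<forall>j\<ge>1.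
      (\<Sum>lam\<in>{lam \<in> partitions n. size lam = j}. c lam) = type_II_formula s t l j \<and>
      (j \<ge> s + t - l - 1 \<longrightarrow> (\<Sum>lam\<in>{lam \<in> partitions n. size lam = j}. c lam) = 0) \<and>
      (j < s + t - l - 1 \<longrightarrow> (\<Sum>lam\<in>{lam \<in> partitions n. size lam = j}. c lam) \<noteq> 0) \<and>
      (\<forall>l'\<in>{0, 1}. type_II_formula s t l' j =
         (-1) ^ (j - 1) * (of_nat ((s + t - 2) choose (j + 1))
           - of_nat ((s - 1) choose (j + 1)) - of_nat ((t - 1) choose (j + 1))))"
proof (intro allI impI conjI)
  fix j :: nat
  assume j: "j \<ge> 1"
  have pos: "k \<ge> 1" "m \<ge> 1"
    using assms(1) by (auto simp: type_II_bicyclic_def theta_graph_def)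
  note coeffs = type_II_star_coefficients[OF assms(1,7,8) j]
  show "(\<Sum>lam\<in>{lam \<in> partitions n. size lam = j}. c lam) = type_II_formula s t l j"
    using coeffs type_II_formula_eq_bracket[OF pos, of l j] assms(2,3) by simp
  \<comment> \<open>Here s+t-l-1 = k+l+m-1 is the largest upper index in the bracket, so all
    binomials with lower index j+1 vanish.\<close>
  show "(\<Sum>lam\<in>{lam \<in> partitions n. size lam = j}. c lam) = 0" if "j \<ge> s + t - l - 1"
    using coeffs that assms(2,3,6) pos by (simp add: theta_bracket_def binomial_eq_0)
  show "(\<Sum>lam\<in>{lam \<in> partitions n. size lam = j}. c lam) \<noteq> 0" if "j < s + t - l - 1"
  proof -
    have "j + 2 \<le> k + l + m"
      using that assms(2,3) by simp
    from theta_binomial_less[OF pos(1) assms(6) pos(2) j this] have "theta_bracket k l m j > 0"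
      unfolding theta_bracket_def by (simp flip: of_nat_add add: algebra_simps)
    then show ?thesis
      using coeffs by simp
  qed
  show "\<forall>l'\<in>{0, 1}. type_II_formula s t l' j =
         (-1) ^ (j - 1) * (of_nat ((s + t - 2) choose (j + 1))
           - of_nat ((s - 1) choose (j + 1)) - of_nat ((t - 1) choose (j + 1)))"
    using type_II_formula_zero_one[of s t] assms(4,5) by auto
qed

end
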